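(* For any $E$-definable composition $\mathcal{M}[\mathcal{N}]$ the following conditions hold: $$\deg^{\exists\text{-}\mathrm{sem}}_{\mathrm{rig}}(\mathcal{M}[\mathcal{N}])=\deg^{\exists\text{-}\mathrm{sem}}_{\mathrm{rig}}(\mathcal{M}),$$ if $\mathcal{N}$ is semantically rigid, and $$\deg^{\exists\text{-}\mathrm{sem}}_{\mathrm{rig}}(\mathcal{M}[\mathcal{N}])=|M|\cdot\deg^{\exists\text{-}\mathrm{sem}}_{\mathrm{rig}}(\mathcal{N}),$$ if $\mathcal{N}$ is not semantically rigid. In particular, $\deg^{\exists\text{-}\mathrm{sem}}_{\mathrm{rig}}(\mathcal{M}[\mathcal{N}])$ is finite iff $\deg^{\exists\text{-}\mathrm{sem}}_{\mathrm{rig}}(\mathcal{M})$ and $\mathcal{N}$ are finite, if $\mathcal{N}$ is semantically rigid, and $\deg^{\exists\text{-}\mathrm{sem}}_{\mathrm{rig}}(\mathcal{N})$ and $\mathcal{M}$ are finite, if $\mathcal{N}$ is not semantically rigid.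
   Context: Universes of $\mathcal{M},\mathcal{N}$ are denoted $M,N$. Composition: for structures $\mathcal{M},\mathcal{N}$ of relational languages $\Sigma_{\mathcal{M}},\Sigma_{\mathcal{N}}$, the composition $\mathcal{M}[\mathcal{N}]$ is the structure of language $\Sigma_{\mathcal{M}}\cup\Sigma_{\mathcal{N}}$ with universe $M\times N$ in which, for an $n$-ary symbol $R$: (i) if $R\in\Sigma_{\mathcal{M}}\setminus\Sigma_{\mathcal{N}}$, then $((a_1,b_1),\ldots,(a_n,b_n))\in R$ iff $(a_1,\ldots,a_n)\in R_{\mathcal{M}}$; (ii) if $R\in\Sigma_{\mathcal{N}}\setminus\Sigma_{\mathcal{M}}$, then $((a_1,b_1),\ldots,(a_n,b_n))\in R$ iff $a_1=\ldots=a_n$ and $(b_1,\ldots,b_n)\in R_{\mathcal{N}}$; (iii) if $R\in\Sigma_{\mathcal{M}}\cap\Sigma_{\mathcal{N}}$, then $((a_1,b_1),\ldots,(a_n,b_n))\in R$ iff $(a_1,\ldots,a_n)\in R_{\mathcal{M}}$, or $a_1=\ldots=a_n$ and $(b_1,\ldots,b_n)\in R_{\mathcal{N}}$. The composition is $E$-definable if $\mathcal{M}[\mathcal{N}]$ has an $\emptyset$-definable equivalence relation $E$ whose classes are the universes $\{a\}\times N$, $a\in M$, of the copies of $\mathcal{N}$ forming $\mathcal{M}[\mathcal{N}]$. A structure $\mathcal{K}$ with universe $K$ is semantically $A$-rigid, for $A\subseteq K$, if its only automorphism fixing $A$ pointwise is the identity; "semantically rigid" means the case $A=\emptyset$. The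 degree $\deg^{\exists\text{-}\mathrm{sem}}_{\mathrm{rig}}(\mathcal{K})$ is the least $n\in\omega$ such that $\mathcal{K}$ is semantically $A$-rigid for some $A\subseteq K$ with $|A|=n$, and is $\infty$ if no such $n$ exists. A product $|M|\cdot d$ with $d>0$ is read as $\infty$ if $M$ is infinite or $d=\infty$.
   Formalization: Assumes each class {a}×N is a copy of N; for rigid N also that, for each shared symbol R, all constant tuples (a,…,a) of M agree on R (the first formula fails otherwise); in the rigid case "N finite" is read as finiteness of the degree of N, as the literal equivalence is false. *)

theory Defs
  imports "HOL-Library.Extended_Nat"
begin

(* Relational structures.  Symbols carry their arity, given by a function ar on the type of
   symbols, so a symbol shared by two languages has the same arity in both.  Only the values of
   interp on symbols of lang are meaningful. *)

record ('r, 'a) rel_struct =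
  univ :: "'a set"
  lang :: "'r set"
  interp :: "'r \<Rightarrow> 'a list set"

definition tuples :: "nat \<Rightarrow> 'a set \<Rightarrow> 'a list set" where
  "tuples n A = {xs. length xs = n \<and> set xs \<subseteq> A}"

definition is_structure :: "('r \<Rightarrow> nat) \<Rightarrow> ('r, 'a) rel_struct \<Rightarrow> bool" where
  "is_structure ar K \<longleftrightarrow> univ K \<noteq> {} \<and> (\<forall>R\<in>lang K. interp K R \<subseteq> tuples (ar R) (univ K))"

definition all_equal :: "'a list \<Rightarrow> bool" where
  "all_equal xs \<longleftrightarrow> (\<forall>x\<in>set xs. \<forall>y\<in>set xs. x = y)"

definition composition ::
  "('r \<Rightarrow> nat) \<Rightarrow> ('r, 'a) rel_struct \<Rightarrow> ('r, 'b) rel_struct \<Rightarrow> ('r, 'a \<times> 'b) rel_struct" where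
  "composition ar M N =
    \<lparr>univ = univ M \<times> univ N,
     lang = lang M \<union> lang N,
     interp = (\<lambda>R. {zs \<in> tuples (ar R) (univ M \<times> univ N).
       (R \<in> lang M \<and> map fst zs \<in> interp M R) \<or>
       (R \<in> lang N \<and> all_equal (map fst zs) \<and> map snd zs \<in> interp N R)})\<rparr>"

(* First-order formulas with equality over relational symbols, variables being natural numbers. *)

datatype 'r fm =
    Eq nat nat
  | Rel 'r "nat list"
  | Neg "'r fm"
  | Conj "'r fm" "'r fm"
  | Ex nat "'r fm"

fun free_vars :: "'r fm \<Rightarrow> nat set" where
  "free_vars (Eq i j) = {i, j}"
| "free_vars (Rel R is) = set is"
| "free_vars (Neg p) = free_vars p"
| "free_vars (Conj p q) = free_vars p \<union> free_vars q"
| "free_vars (Ex i p) = free_vars p - {i}"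

fun in_language :: "('r \<Rightarrow> nat) \<Rightarrow> 'r set \<Rightarrow> 'r fm \<Rightarrow> bool" where
  "in_language ar L (Eq i j) \<longleftrightarrow> True"
| "in_language ar L (Rel R is) \<longleftrightarrow> R \<in> L \<and> length is = ar R"
| "in_language ar L (Neg p) \<longleftrightarrow> in_language ar L p"
| "in_language ar L (Conj p q) \<longleftrightarrow> in_language ar L p \<and> in_language ar L q"
| "in_language ar L (Ex i p) \<longleftrightarrow> in_language ar L p"

fun sat :: "('r, 'a) rel_struct \<Rightarrow> (nat \<Rightarrow> 'a) \<Rightarrow> 'r fm \<Rightarrow> bool" where
  "sat K e (Eq i j) \<longleftrightarrow> e i = e j"
| "sat K e (Rel R is) \<longleftrightarrow> map e is \<in> interp K R"
| "sat K e (Neg p) \<longleftrightarrow> \<not> sat K e p"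
| "sat K e (Conj p q) \<longleftrightarrow> sat K e p \<and> sat K e q"
| "sat K e (Ex i p) \<longleftrightarrow> (\<exists>x\<in>univ K. sat K (e(i := x)) p)"

(* Parameter-free definability of a binary relation: the variables 0 and 1 stand for the two
   arguments, and since no other variable is free, the remaining values of the assignment do not
   matter. *)

definition definable_rel ::
  "('r \<Rightarrow> nat) \<Rightarrow> ('r, 'a) rel_struct \<Rightarrow> ('a \<times> 'a) set \<Rightarrow> bool" where
  "definable_rel ar K E \<longleftrightarrow>
    (\<exists>p. in_language ar (lang K) p \<and> free_vars p \<subseteq> {0, 1} \<and>
      E = {(x, y). x \<in> univ K \<and> y \<in> univ K \<and> sat K ((\<lambda>_. x)(1 := y)) p})"

definition E_definable ::
  "('r \<Rightarrow> nat) \<Rightarrow> ('r, 'a) rel_struct \<Rightarrow> ('r, 'b) rel_struct \<Rightarrow> bool" where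
  "E_definable ar M N \<longleftrightarrow>
    (\<exists>E. definable_rel ar (composition ar M N) E \<and>
      equiv (univ (composition ar M N)) E \<and>
      univ (composition ar M N) // E = {{a} \<times> univ N | a. a \<in> univ M})"

(* The classes {a} \<times> N are copies of N, in the language of N.  This is not automatic: if
   R is a shared symbol and M has a constant R-tuple (a,...,a), then the last clause of the
   composition puts every tuple over a into R, so that the fibre over a is a copy of N only if
   R is full on N.  For disjoint languages, and when M has no constant R-tuples for shared R, the
   condition always holds. *)

definition fibres_are_copies ::
  "('r \<Rightarrow> nat) \<Rightarrow> ('r, 'a) rel_struct \<Rightarrow> ('r, 'b) rel_struct \<Rightarrow> bool" where
  "fibres_are_copies ar M N \<longleftrightarrow>
    (\<forall>a\<in>univ M. \<forall>R\<in>lang N. \<forall>xs\<in>tuples (ar R) (univ N).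
      xs \<in> interp N R \<longleftrightarrow> map (Pair a) xs \<in> interp (composition ar M N) R)"

(* If a shared symbol R is full on N, then M[N] does not show which constant tuples of M belong
   to R, and M[N] may have automorphisms that do not come from M.  This cannot happen if the
   constant tuples of M behave alike, as they do when R is irreflexive or reflexive on M.
   Example where it does happen: M = {0, 1} with R = {0} and N = {b} with R = {b}, R unary; both
   are rigid, but R holds everywhere in M[N], which has the nontrivial automorphism
   interchanging (0, b) and (1, b). *)

definition constant_tuples_uniform ::
  "('r \<Rightarrow> nat) \<Rightarrow> ('r, 'a) rel_struct \<Rightarrow> ('r, 'b) rel_struct \<Rightarrow> bool" where
  "constant_tuples_uniform ar M N \<longleftrightarrow>
    (\<forall>R\<in>lang M \<inter> lang N. \<forall>a\<in>univ M. \<forall>b\<in>univ M.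
      replicate (ar R) a \<in> interp M R \<longleftrightarrow> replicate (ar R) b \<in> interp M R)"

(* Maps are considered on the universe only. *)

definition automorphism :: "('r \<Rightarrow> nat) \<Rightarrow> ('r, 'a) rel_struct \<Rightarrow> ('a \<Rightarrow> 'a) \<Rightarrow> bool" where
  "automorphism ar K f \<longleftrightarrow>
    bij_betw f (univ K) (univ K) \<and>
    (\<forall>R\<in>lang K. \<forall>xs\<in>tuples (ar R) (univ K). xs \<in> interp K R \<longleftrightarrow> map f xs \<in> interp K R)"

definition sem_rigid_over :: "('r \<Rightarrow> nat) \<Rightarrow> ('r, 'a) rel_struct \<Rightarrow> 'a set \<Rightarrow> bool" where
  "sem_rigid_over ar K A \<longleftrightarrow>
    (\<forall>f. automorphism ar K f \<and> (\<forall>x\<in>A. f x = x) \<longrightarrow> (\<forall>x\<in>univ K. f x = x))"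

definition sem_rigid :: "('r \<Rightarrow> nat) \<Rightarrow> ('r, 'a) rel_struct \<Rightarrow> bool" where
  "sem_rigid ar K \<longleftrightarrow> sem_rigid_over ar K {}"

definition rigid_by :: "('r \<Rightarrow> nat) \<Rightarrow> ('r, 'a) rel_struct \<Rightarrow> nat \<Rightarrow> bool" where
  "rigid_by ar K n \<longleftrightarrow>
    (\<exists>A\<subseteq>univ K. finite A \<and> card A = n \<and> sem_rigid_over ar K A)"

definition deg_rig :: "('r \<Rightarrow> nat) \<Rightarrow> ('r, 'a) rel_struct \<Rightarrow> enat" where
  "deg_rig ar K =
    (if \<exists>n. rigid_by ar K n then enat (LEAST n. rigid_by ar K n) else \<infinity>)"

definition ecard :: "'a set \<Rightarrow> enat" where
  "ecard A = (if finite A then enat (card A) else \<infinity>)"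

end

theory Submission imports Defs begin

text \<open>
  Two kinds of automorphisms of the composition \<open>M[N]\<close> are always available: an automorphism
  of \<open>M\<close> acting on first coordinates, and an automorphism of \<open>N\<close> acting inside a single fibre
  \<open>{a} \<times> N\<close>.  They give the lower bounds.  If \<open>M[N]\<close> is rigid over \<open>B\<close>, then \<open>M\<close> is rigid over
  the projection of \<open>B\<close> (\<open>rigid_over_projection\<close>), and \<open>N\<close> is rigid over every section of \<open>B\<close>
  (\<open>rigid_over_section\<close>); when \<open>N\<close> is not rigid, each of the \<open>|M|\<close> sections has at least
  \<open>deg N > 0\<close> elements, so \<open>B\<close> has at least \<open>|M| * deg N\<close>.

  The upper bounds go the other way, from an automorphism of \<open>M[N]\<close> to automorphisms of \<open>M\<close> and
  \<open>N\<close>, and this is where definability of \<open>E\<close> enters.  Automorphisms preserve formulas, hence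
  \<open>E\<close>, hence permute the fibres.  The permutation of the fibres is an automorphism of \<open>M\<close> if
  constant tuples of \<open>M\<close> behave uniformly, and a fibre mapped to itself carries an automorphism
  of \<open>N\<close>.  If \<open>N\<close> is rigid and constant tuples are uniform, fixing one point above each element of
  a base set for \<open>M\<close> therefore fixes everything.  If \<open>N\<close> is not rigid, a base set \<open>A\<close> for \<open>N\<close> is nonempty, so fixing
  \<open>M \<times> A\<close> fixes every fibre setwise and then pointwise.
\<close>

section \<open>The rigidity degree as a minimum\<close>

lemma deg_rig_le_card:
  assumes "A \<subseteq> univ K" "finite A" "sem_rigid_over ar K A"
  shows "deg_rig ar K \<le> enat (card A)"
proof -
  have "rigid_by ar K (card A)"
    using assms by (auto simp: rigid_by_def)
  then show ?thesis
    by (auto simp: deg_rig_def intro: Least_le)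
qed

lemma deg_rig_attained:
  assumes "deg_rig ar K \<noteq> \<infinity>"
  obtains A where "A \<subseteq> univ K" "finite A" "sem_rigid_over ar K A" "deg_rig ar K = enat (card A)"
proof -
  define n where "n = (LEAST n. rigid_by ar K n)"
  have ex: "\<exists>n. rigid_by ar K n"
    using assms by (auto simp: deg_rig_def split: if_splits)
  then have "rigid_by ar K n"
    unfolding n_def by (rule LeastI_ex)
  then obtain A where "A \<subseteq> univ K" "finite A" "card A = n" "sem_rigid_over ar K A"
    unfolding rigid_by_def by blast
  moreover have "deg_rig ar K = enat n"
    using ex by (simp add: deg_rig_def n_def)
  ultimately show thesis
    using that by blast
qed

lemma deg_rig_greatest:
  assumes "\<And>A. A \<subseteq> univ K \<Longrightarrow> finite A \<Longrightarrow> sem_rigid_over ar K A \<Longrightarrow> e \<le> enat (card A)"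
  shows "e \<le> deg_rig ar K"
proof (cases "deg_rig ar K = \<infinity>")
  case False
  then obtain A where "A \<subseteq> univ K" "finite A" "sem_rigid_over ar K A"
    "deg_rig ar K = enat (card A)"
    by (rule deg_rig_attained)
  then show ?thesis
    using assms by simp
qed simp

lemma deg_rig_eq_0_iff: "deg_rig ar K = 0 \<longleftrightarrow> sem_rigid ar K"
proof
  assume zero: "deg_rig ar K = 0"
  then have "deg_rig ar K \<noteq> \<infinity>" by simp
  then obtain A where "finite A" "sem_rigid_over ar K A" "deg_rig ar K = enat (card A)"
    by (rule deg_rig_attained)
  with zero show "sem_rigid ar K"
    by (auto simp: sem_rigid_def enat_0_iff)
next
  assume "sem_rigid ar K"
  then show "deg_rig ar K = 0"
    using deg_rig_le_card[of "{}" K ar] by (simp add: sem_rigid_def zero_enat_def[symmetric])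
qed

section \<open>Automorphisms and definable relations\<close>

lemma automorphism_maps_univ: "automorphism ar K f \<Longrightarrow> x \<in> univ K \<Longrightarrow> f x \<in> univ K"
  by (auto simp: automorphism_def bij_betw_def)

lemma sem_rigid_overD:
  assumes "sem_rigid_over ar K A" "automorphism ar K f" "\<And>x. x \<in> A \<Longrightarrow> f x = x" "x \<in> univ K"
  shows "f x = x"
  using assms by (simp add: sem_rigid_over_def)

lemma sat_automorphism:
  assumes "automorphism ar K f" "in_language ar (lang K) p" "\<And>i. e i \<in> univ K"
  shows "sat K (f \<circ> e) p \<longleftrightarrow> sat K e p"
  using assms(2,3)
proof (induction p arbitrary: e)
  case (Eq i j)
  then show ?case
    using assms(1) by (auto simp: automorphism_def bij_betw_def dest: inj_onD)
next
  case (Rel R js)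
  then have "map e js \<in> tuples (ar R) (univ K)"
    by (auto simp: tuples_def)
  then show ?case
    using assms(1) Rel by (simp add: automorphism_def comp_def)
next
  case (Ex i p)
  have step: "sat K ((f \<circ> e)(i := f x)) p \<longleftrightarrow> sat K (e(i := x)) p" if "x \<in> univ K" for x
  proof -
    have "sat K (f \<circ> e(i := x)) p \<longleftrightarrow> sat K (e(i := x)) p"
      using Ex.prems that by (intro Ex.IH) auto
    then show ?thesis
      by (simp only: fun_upd_comp)
  qed
  \<comment> \<open>Witnesses correspond under \<open>f\<close> because it is onto the universe.\<close>
  have "f ` univ K = univ K"
    using assms(1) by (simp add: automorphism_def bij_betw_def)
  moreover have "(\<exists>y\<in>f ` univ K. sat K ((f \<circ> e)(i := y)) p) \<longleftrightarrow>
      (\<exists>x\<in>univ K. sat K ((f \<circ> e)(i := f x)) p)"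
    by blast
  ultimately have "(\<exists>y\<in>univ K. sat K ((f \<circ> e)(i := y)) p) \<longleftrightarrow>
      (\<exists>x\<in>univ K. sat K ((f \<circ> e)(i := f x)) p)"
    by (simp only:)
  then show ?case
    by (simp only: sat.simps step cong: bex_cong)
qed auto

lemma automorphism_preserves_definable_rel:
  assumes "automorphism ar K f" "definable_rel ar K E" "x \<in> univ K" "y \<in> univ K"
  shows "(f x, f y) \<in> E \<longleftrightarrow> (x, y) \<in> E"
proof -
  obtain p where p: "in_language ar (lang K) p"
    and E: "E = {(x, y). x \<in> univ K \<and> y \<in> univ K \<and> sat K ((\<lambda>_. x)(1 := y)) p}"
    using assms(2) by (auto simp: definable_rel_def)
  have "f \<circ> ((\<lambda>_. x)(1 := y)) = (\<lambda>_. f x)(1 := f y)"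
    by auto
  then have "sat K ((\<lambda>_. f x)(1 := f y)) p \<longleftrightarrow> sat K ((\<lambda>_. x)(1 := y)) p"
    using sat_automorphism[OF assms(1) p, of "(\<lambda>_. x)(1 := y)"] assms(3,4)
    by (metis fun_upd_apply)
  then show ?thesis
    using assms automorphism_maps_univ[OF assms(1)] by (simp add: E)
qed

section \<open>Building automorphisms of a composition\<close>

lemma univ_composition [simp]: "univ (composition ar M N) = univ M \<times> univ N"
  by (simp add: composition_def)

lemma all_equal_map_inj_on:
  assumes "inj_on g A" "set xs \<subseteq> A"
  shows "all_equal (map g xs) \<longleftrightarrow> all_equal xs"
proof -
  have "g x = g y \<longleftrightarrow> x = y" if "x \<in> set xs" "y \<in> set xs" for x y
    using assms that by (meson inj_on_eq_iff subsetD)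
  then show ?thesis
    by (simp add: all_equal_def)
qed

lemma automorphism_on_base:
  assumes "automorphism ar M g"
  shows "automorphism ar (composition ar M N) (\<lambda>(a, b). (g a, b))"
proof -
  let ?f = "\<lambda>(a, b). (g a, b)"
  have g: "bij_betw g (univ M) (univ M)"
    using assms by (simp add: automorphism_def)
  have "bij_betw ?f (univ M \<times> univ N) (univ M \<times> univ N)"
    using bij_betw_map_prod[OF g bij_betw_id[of "univ N"]]
    by (simp add: map_prod_def id_def)
  moreover have "zs \<in> interp (composition ar M N) R \<longleftrightarrow>
      map ?f zs \<in> interp (composition ar M N) R"
    if zs: "zs \<in> tuples (ar R) (univ M \<times> univ N)" for R zs
  proof -
    have coords: "map fst (map ?f zs) = map g (map fst zs)" "map snd (map ?f zs) = map snd zs"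
      by (auto simp: case_prod_beta)
    have "map fst zs \<in> tuples (ar R) (univ M)"
      using zs by (auto simp: tuples_def)
    then have "R \<in> lang M \<Longrightarrow> map fst zs \<in> interp M R \<longleftrightarrow> map g (map fst zs) \<in> interp M R"
      using assms by (simp add: automorphism_def del: map_map)
    moreover have "all_equal (map g (map fst zs)) \<longleftrightarrow> all_equal (map fst zs)"
      using g zs by (intro all_equal_map_inj_on) (auto simp: bij_betw_def tuples_def)
    moreover have "map ?f zs \<in> tuples (ar R) (univ M \<times> univ N)"
      using zs g by (fastforce simp: tuples_def bij_betw_def)
    ultimately show ?thesis
      using zs by (auto simp: composition_def coords simp del: map_map)
  qed
  ultimately show ?thesis
    by (simp add: automorphism_def)
qed

lemma automorphism_on_fibre:
  assumes "automorphism ar N h"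
  shows "automorphism ar (composition ar M N) (\<lambda>(c, b). (c, if c = a then h b else b))"
proof -
  let ?f = "\<lambda>(c, b). (c, if c = a then h b else b)"
  have h: "bij_betw h (univ N) (univ N)"
    using assms by (simp add: automorphism_def)
  have "inj_on ?f (univ M \<times> univ N)"
  proof (rule inj_onI)
    fix x y assume "x \<in> univ M \<times> univ N" "y \<in> univ M \<times> univ N" "?f x = ?f y"
    then show "x = y"
      using inj_onD[OF bij_betw_imp_inj_on[OF h], of "snd x" "snd y"]
      by (cases x; cases y; cases "fst x = a") auto
  qed
  moreover have maps: "?f ` (univ M \<times> univ N) \<subseteq> univ M \<times> univ N"
    using bij_betw_apply[OF h] by auto
  moreover have "(c, b) \<in> ?f ` (univ M \<times> univ N)" if "c \<in> univ M" "b \<in> univ N" for c b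
  proof -
    obtain d where "d \<in> univ N" "(if c = a then h d else d) = b"
      using \<open>b \<in> univ N\<close> bij_betw_imp_surj_on[OF h] by (cases "c = a") force+
    then show ?thesis
      using \<open>c \<in> univ M\<close> by (intro image_eqI[of _ _ "(c, d)"]) auto
  qed
  ultimately have "bij_betw ?f (univ M \<times> univ N) (univ M \<times> univ N)"
    by (intro bij_betw_imageI equalityI subsetI) auto
  moreover have "zs \<in> interp (composition ar M N) R \<longleftrightarrow>
      map ?f zs \<in> interp (composition ar M N) R"
    if zs: "zs \<in> tuples (ar R) (univ M \<times> univ N)" for R zs
  proof -
    have fst_eq: "map fst (map ?f zs) = map fst zs"
      by auto
    have snd_eq: "map snd zs \<in> interp N R \<longleftrightarrow> map snd (map ?f zs) \<in> interp N R"
      if "R \<in> lang N" "all_equal (map fst zs)"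
    proof (cases "a \<in> fst ` set zs")
      case True
      then have "map snd (map ?f zs) = map h (map snd zs)"
        using that(2) by (fastforce simp: all_equal_def)
      moreover have "map snd zs \<in> tuples (ar R) (univ N)"
        using zs by (auto simp: tuples_def)
      ultimately show ?thesis
        using assms that(1) by (simp add: automorphism_def del: map_map)
    next
      case False
      then have "map ?f zs = zs"
        by (force intro!: map_idI)
      then show ?thesis by simp
    qed
    have "map ?f zs \<in> tuples (ar R) (univ M \<times> univ N)"
      using zs maps by (auto simp: tuples_def simp del: split_paired_All)
    then show ?thesis
      using zs snd_eq by (auto simp: composition_def fst_eq simp del: map_map)
  qed
  ultimately show ?thesis
    by (simp add: automorphism_def)
qed

text \<open>
  An automorphism of \<open>M\<close> that fixes the projection of \<open>B\<close>, acting on first coordinates, fixes \<open>B\<close>;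
  so does an automorphism of \<open>N\<close> that fixes a section of \<open>B\<close>, acting on the fibre of that section.
\<close>

lemma rigid_over_projection:
  assumes "sem_rigid_over ar (composition ar M N) B" "univ N \<noteq> {}"
  shows "sem_rigid_over ar M (fst ` B)"
  unfolding sem_rigid_over_def
proof (intro allI impI ballI)
  fix g a
  assume g: "automorphism ar M g \<and> (\<forall>x\<in>fst ` B. g x = x)" and a: "a \<in> univ M"
  obtain b where "b \<in> univ N"
    using assms(2) by blast
  let ?f = "\<lambda>(a, b). (g a, b)"
  have "?f (a, b) = (a, b)"
  proof (rule sem_rigid_overD[OF assms(1)])
    show "automorphism ar (composition ar M N) ?f"
      using g by (intro automorphism_on_base) simp
    show "?f x = x" if "x \<in> B" for x
      using g that by (cases x) force
    show "(a, b) \<in> univ (composition ar M N)"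
      using a \<open>b \<in> univ N\<close> by simp
  qed
  then show "g a = a"
    by simp
qed

lemma rigid_over_section:
  assumes "sem_rigid_over ar (composition ar M N) B" "a \<in> univ M"
  shows "sem_rigid_over ar N (B `` {a})"
  unfolding sem_rigid_over_def
proof (intro allI impI ballI)
  fix h b
  assume h: "automorphism ar N h \<and> (\<forall>x\<in>B `` {a}. h x = x)" and b: "b \<in> univ N"
  let ?f = "\<lambda>(c, b). (c, if c = a then h b else b)"
  have "?f (a, b) = (a, b)"
  proof (rule sem_rigid_overD[OF assms(1)])
    show "automorphism ar (composition ar M N) ?f"
      using h by (intro automorphism_on_fibre) simp
    show "?f x = x" if "x \<in> B" for x
      using h that by (cases x) auto
    show "(a, b) \<in> univ (composition ar M N)"
      using assms(2) b by simp
  qed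
  then show "h b = b"
    by simp
qed

section \<open>Decomposing automorphisms of a definable composition\<close>

text \<open>
  Two points lie in the same fibre iff they are related by the definable relation \<open>E\<close>, which
  automorphisms preserve in both directions.
\<close>

lemma automorphism_permutes_fibres:
  assumes "E_definable ar M N" "automorphism ar (composition ar M N) f"
    and "x \<in> univ M \<times> univ N" "y \<in> univ M \<times> univ N"
  shows "fst (f x) = fst (f y) \<longleftrightarrow> fst x = fst y"
proof -
  obtain E where E: "definable_rel ar (composition ar M N) E"
    "equiv (univ M \<times> univ N) E"
    "(univ M \<times> univ N) // E = {{a} \<times> univ N | a. a \<in> univ M}"
    using assms(1) by (auto simp: E_definable_def)
  have E_iff: "(u, v) \<in> E \<longleftrightarrow> fst u = fst v"
    if "u \<in> univ M \<times> univ N" "v \<in> univ M \<times> univ N" for u v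
  proof -
    have "E `` {u} \<in> (univ M \<times> univ N) // E"
      using that by (intro quotientI)
    then obtain a where a: "E `` {u} = {a} \<times> univ N"
      unfolding E(3) by blast
    moreover have "u \<in> E `` {u}"
      using equiv_class_self[OF E(2)] that by simp
    ultimately have "E `` {u} = {fst u} \<times> univ N"
      by auto
    then have "(u, v) \<in> E \<longleftrightarrow> v \<in> {fst u} \<times> univ N"
      by blast
    then show ?thesis
      using that by (auto simp: mem_Times_iff)
  qed
  have "f x \<in> univ M \<times> univ N" "f y \<in> univ M \<times> univ N"
    using automorphism_maps_univ[OF assms(2)] assms(3,4) by simp_all
  then show ?thesis
    using automorphism_preserves_definable_rel[OF assms(2) E(1), of x y] assms(3,4)
    by (simp add: E_iff)
qed

lemma induced_automorphism_on_fibre: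
  assumes "E_definable ar M N" "fibres_are_copies ar M N"
    and f: "automorphism ar (composition ar M N) f"
    and a: "a \<in> univ M" "\<And>b. b \<in> univ N \<Longrightarrow> fst (f (a, b)) = a"
  shows "automorphism ar N (\<lambda>b. snd (f (a, b)))"
proof -
  let ?h = "\<lambda>b. snd (f (a, b))"
  have bij: "bij_betw f (univ M \<times> univ N) (univ M \<times> univ N)"
    using f by (simp add: automorphism_def)
  have f_eq: "f (a, b) = (a, ?h b)" if "b \<in> univ N" for b
    using a(2)[OF that] by (metis prod.collapse)
  have h_univ: "?h b \<in> univ N" if "b \<in> univ N" for b
    using automorphism_maps_univ[OF f, of "(a, b)"] a that by (simp add: mem_Times_iff)
  have "inj_on ?h (univ N)"
  proof (rule inj_onI)
    fix b b' assume b: "b \<in> univ N" "b' \<in> univ N" "?h b = ?h b'"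
    then have "f (a, b) = f (a, b')"
      using f_eq by metis
    then show "b = b'"
      using inj_onD[OF bij_betw_imp_inj_on[OF bij], of "(a, b)" "(a, b')"] a(1) b by simp
  qed
  moreover have "?h ` univ N = univ N"
  proof (intro equalityI subsetI)
    fix b assume "b \<in> ?h ` univ N"
    then show "b \<in> univ N"
      using h_univ by auto
  next
    fix b assume b: "b \<in> univ N"
    then have "(a, b) \<in> f ` (univ M \<times> univ N)"
      using a(1) by (simp add: bij_betw_imp_surj_on[OF bij])
    then obtain x where x: "(a, b) = f x" "x \<in> univ M \<times> univ N"
      by (rule imageE)
    \<comment> \<open>A preimage in another fibre would make \<open>f\<close> merge two fibres.\<close>
    have "fst (f x) = fst (f (a, b))"
      using a(2)[OF b] by (simp add: x(1)[symmetric])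
    then have "fst x = a"
      using automorphism_permutes_fibres[OF assms(1) f x(2), of "(a, b)"] a(1) b by simp
    then have "x = (a, snd x)"
      by (simp add: prod_eq_iff)
    then have "?h (snd x) = b"
      using x(1) by (metis snd_conv)
    moreover have "snd x \<in> univ N"
      using x(2) by (simp add: mem_Times_iff)
    ultimately show "b \<in> ?h ` univ N"
      by (intro image_eqI[of _ _ "snd x"]) simp_all
  qed
  ultimately have "bij_betw ?h (univ N) (univ N)"
    by (rule bij_betw_imageI)
  moreover have "xs \<in> interp N R \<longleftrightarrow> map ?h xs \<in> interp N R"
    if R: "R \<in> lang N" and xs: "xs \<in> tuples (ar R) (univ N)" for R xs
  proof -
    let ?C = "interp (composition ar M N) R"
    have "xs \<in> interp N R \<longleftrightarrow> map (Pair a) xs \<in> ?C"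
      using assms(2) a(1) R xs by (simp add: fibres_are_copies_def)
    also have "\<dots> \<longleftrightarrow> map f (map (Pair a) xs) \<in> ?C"
    proof -
      have "map (Pair a) xs \<in> tuples (ar R) (univ M \<times> univ N)"
        using xs a(1) by (auto simp: tuples_def)
      moreover have "R \<in> lang (composition ar M N)"
        using R by (simp add: composition_def)
      ultimately show ?thesis
        using f by (simp add: automorphism_def del: map_map)
    qed
    also have "map f (map (Pair a) xs) = map (Pair a) (map ?h xs)"
      using xs f_eq by (auto simp: tuples_def)
    also have "\<dots> \<in> ?C \<longleftrightarrow> map ?h xs \<in> interp N R"
    proof -
      have "map ?h xs \<in> tuples (ar R) (univ N)"
        using xs h_univ by (auto simp: tuples_def)
      then show ?thesis
        using assms(2) a(1) R by (simp add: fibres_are_copies_def del: map_map)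
    qed
    finally show ?thesis .
  qed
  ultimately show ?thesis
    by (simp add: automorphism_def)
qed

text \<open>
  Lifting a tuple of \<open>M\<close> to height \<open>b\<close> reflects the relations of \<open>M\<close> as long as the
  tuple cannot owe its relation in \<open>M[N]\<close> to a relation of \<open>N\<close> inside a fibre; this is possible
  only for constant tuples and shared symbols.
\<close>

lemma lifted_tuple_in_composition_iff:
  assumes "R \<in> lang M" "b \<in> univ N" "xs \<in> tuples (ar R) (univ M)"
    and "R \<notin> lang N \<or> \<not> all_equal xs"
  shows "map (\<lambda>a. (a, b)) xs \<in> interp (composition ar M N) R \<longleftrightarrow> xs \<in> interp M R"
proof -
  have "map fst (map (\<lambda>a. (a, b)) xs) = xs"
    by (simp add: comp_def)
  moreover have "map (\<lambda>a. (a, b)) xs \<in> tuples (ar R) (univ M \<times> univ N)"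
    using assms(2,3) by (auto simp: tuples_def)
  ultimately show ?thesis
    using assms(1,4) by (auto simp: composition_def simp del: map_map)
qed

text \<open>
  The lifted tuples show that the induced map on \<open>M\<close> preserves all relations except possibly
  shared ones on constant tuples, which the fibres may hide; for those uniformity is assumed.
\<close>

lemma induced_automorphism_on_base:
  assumes "E_definable ar M N" "constant_tuples_uniform ar M N"
    and f: "automorphism ar (composition ar M N) f" and b: "b \<in> univ N"
  shows "automorphism ar M (\<lambda>a. fst (f (a, b)))"
proof -
  let ?g = "\<lambda>a. fst (f (a, b))"
  have bij: "bij_betw f (univ M \<times> univ N) (univ M \<times> univ N)"
    using f by (simp add: automorphism_def)
  have f_univ: "f (a, d) \<in> univ M \<times> univ N" if "a \<in> univ M" "d \<in> univ N" for a d
    using automorphism_maps_univ[OF f, of "(a, d)"] that by simp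
  have g_univ: "?g a \<in> univ M" if "a \<in> univ M" for a
    using f_univ[OF that b] by (simp add: mem_Times_iff)
  have fibres: "fst (f (a, d)) = fst (f (a', d')) \<longleftrightarrow> a = a'"
    if "a \<in> univ M" "a' \<in> univ M" "d \<in> univ N" "d' \<in> univ N" for a a' d d'
    using automorphism_permutes_fibres[OF assms(1) f, of "(a, d)" "(a', d')"] that by simp
  have inj: "inj_on ?g (univ M)"
    using fibres b by (auto intro: inj_onI)
  moreover have "?g ` univ M = univ M"
  proof (intro equalityI subsetI)
    fix a assume "a \<in> ?g ` univ M"
    then show "a \<in> univ M"
      using g_univ by auto
  next
    fix a assume a: "a \<in> univ M"
    then have "(a, b) \<in> f ` (univ M \<times> univ N)"
      using b by (simp add: bij_betw_imp_surj_on[OF bij])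
    then obtain x where x: "(a, b) = f x" "x \<in> univ M \<times> univ N"
      by (rule imageE)
    then have fst_x: "fst x \<in> univ M"
      by (simp add: mem_Times_iff)
    then have "?g (fst x) = fst (f x)"
      using automorphism_permutes_fibres[OF assms(1) f _ x(2), of "(fst x, b)"] b by simp
    then have "?g (fst x) = a"
      by (simp add: x(1)[symmetric])
    then show "a \<in> ?g ` univ M"
      using fst_x by (intro image_eqI[of _ _ "fst x"]) simp_all
  qed
  ultimately have "bij_betw ?g (univ M) (univ M)"
    by (rule bij_betw_imageI)
  moreover have "xs \<in> interp M R \<longleftrightarrow> map ?g xs \<in> interp M R"
    if R: "R \<in> lang M" and xs: "xs \<in> tuples (ar R) (univ M)" for R xs
  proof (cases "R \<in> lang N \<and> all_equal xs")
    case True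
    show ?thesis
    proof (cases xs)
      case (Cons a ys)
      then have xs_eq: "xs = replicate (ar R) a" and a: "a \<in> univ M"
        using True xs by (auto simp: tuples_def all_equal_def intro!: replicate_eqI)
      have "replicate (ar R) a \<in> interp M R \<longleftrightarrow> replicate (ar R) (?g a) \<in> interp M R"
        using assms(2) R True a g_univ[OF a] unfolding constant_tuples_uniform_def by blast
      then show ?thesis
        unfolding xs_eq by (simp only: map_replicate)
    qed simp
  next
    case False
    let ?C = "interp (composition ar M N) R"
    let ?zs = "map (\<lambda>a. (a, b)) xs"
    have zs: "?zs \<in> tuples (ar R) (univ M \<times> univ N)"
      using xs b by (auto simp: tuples_def)
    have f_zs: "map f ?zs \<in> tuples (ar R) (univ M \<times> univ N)"
      using zs automorphism_maps_univ[OF f] unfolding tuples_def by fastforce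
    have not_const: "R \<notin> lang N \<or> \<not> all_equal (map ?g xs)"
      using False all_equal_map_inj_on[OF inj] xs by (auto simp: tuples_def)
    have "xs \<in> interp M R \<longleftrightarrow> ?zs \<in> ?C"
      using False R b xs by (subst lifted_tuple_in_composition_iff) auto
    also have "\<dots> \<longleftrightarrow> map f ?zs \<in> ?C"
    proof -
      have "R \<in> lang (composition ar M N)"
        using R by (simp add: composition_def)
      then show ?thesis
        using f zs by (simp add: automorphism_def del: map_map)
    qed
    also have "\<dots> \<longleftrightarrow> map ?g xs \<in> interp M R"
    proof -
      have "map fst (map f ?zs) = map ?g xs"
        by simp
      then show ?thesis
        using f_zs not_const R by (auto simp: composition_def simp del: map_map)
    qed
    finally show ?thesis .
  qed
  ultimately show ?thesis
    by (simp add: automorphism_def)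
qed

section \<open>The two degree formulas\<close>

text \<open>
  Base sets of \<open>M\<close> and of \<open>M[N]\<close> are exchanged by lifting to a constant height and by projecting;
  neither increases the cardinality.
\<close>

lemma deg_rig_composition_rigid:
  assumes "univ N \<noteq> {}" "E_definable ar M N" "fibres_are_copies ar M N"
    and "sem_rigid ar N" "constant_tuples_uniform ar M N"
  shows "deg_rig ar (composition ar M N) = deg_rig ar M"
proof (rule antisym)
  obtain b where b: "b \<in> univ N"
    using assms(1) by blast
  show "deg_rig ar (composition ar M N) \<le> deg_rig ar M"
  proof (rule deg_rig_greatest)
    fix A assume A: "A \<subseteq> univ M" "finite A" "sem_rigid_over ar M A"
    have "sem_rigid_over ar (composition ar M N) (A \<times> {b})"
      unfolding sem_rigid_over_def
    proof (intro allI impI)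
      fix f assume "automorphism ar (composition ar M N) f \<and> (\<forall>x\<in>A \<times> {b}. f x = x)"
      then have f: "automorphism ar (composition ar M N) f" and fixed: "\<forall>x\<in>A \<times> {b}. f x = x"
        by auto
      have "fst (f (a, b)) = a" if "a \<in> univ M" for a
        using sem_rigid_overD[OF A(3) induced_automorphism_on_base[OF assms(2,5) f b]] fixed that
        by simp
      then have fibre: "fst (f (a, d)) = a" if "a \<in> univ M" "d \<in> univ N" for a d
        using automorphism_permutes_fibres[OF assms(2) f, of "(a, d)" "(a, b)"] that b by simp
      moreover have "snd (f (a, d)) = d" if "a \<in> univ M" "d \<in> univ N" for a d
        using sem_rigid_overD[OF assms(4)[unfolded sem_rigid_def]
            induced_automorphism_on_fibre[OF assms(2,3) f that(1)]] fibre that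
        by simp
      ultimately show "\<forall>x\<in>univ (composition ar M N). f x = x"
        by (auto simp: prod_eq_iff)
    qed
    then have "deg_rig ar (composition ar M N) \<le> enat (card (A \<times> {b}))"
      using A b by (intro deg_rig_le_card) auto
    then show "deg_rig ar (composition ar M N) \<le> enat (card A)"
      by (simp add: card_cartesian_product)
  qed
  show "deg_rig ar M \<le> deg_rig ar (composition ar M N)"
  proof (rule deg_rig_greatest)
    fix B assume B: "B \<subseteq> univ (composition ar M N)" "finite B"
      "sem_rigid_over ar (composition ar M N) B"
    then have "deg_rig ar M \<le> enat (card (fst ` B))"
      using rigid_over_projection[OF B(3) assms(1)] by (intro deg_rig_le_card) auto
    also have "\<dots> \<le> enat (card B)"
      using B(2) by (simp add: card_image_le)
    finally show "deg_rig ar M \<le> enat (card B)" .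
  qed
qed

lemma ecard_times_deg_rig_finite_iff:
  assumes "A \<noteq> {}" "\<not> sem_rigid ar N"
  shows "ecard A * deg_rig ar N \<noteq> \<infinity> \<longleftrightarrow> deg_rig ar N \<noteq> \<infinity> \<and> finite A"
proof -
  have "deg_rig ar N \<noteq> 0"
    using assms(2) by (simp add: deg_rig_eq_0_iff)
  moreover have "ecard A \<noteq> 0" "ecard A = \<infinity> \<longleftrightarrow> infinite A"
    using assms(1) by (auto simp: ecard_def zero_enat_def)
  ultimately show ?thesis
    by (auto simp: imult_is_infinity)
qed

lemma deg_rig_composition_le_product:
  assumes "univ M \<noteq> {}" "E_definable ar M N" "fibres_are_copies ar M N" "\<not> sem_rigid ar N"
  shows "deg_rig ar (composition ar M N) \<le> ecard (univ M) * deg_rig ar N"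
proof (cases "finite (univ M) \<and> deg_rig ar N \<noteq> \<infinity>")
  case True
  then obtain A where A: "A \<subseteq> univ N" "finite A" "sem_rigid_over ar N A"
    "deg_rig ar N = enat (card A)"
    using deg_rig_attained by metis
  have "A \<noteq> {}"
    using A(3) assms(4) by (auto simp: sem_rigid_def)
  then obtain b where b: "b \<in> A"
    by blast
  have "sem_rigid_over ar (composition ar M N) (univ M \<times> A)"
    unfolding sem_rigid_over_def
  proof (intro allI impI)
    fix f assume "automorphism ar (composition ar M N) f \<and> (\<forall>x\<in>univ M \<times> A. f x = x)"
    then have f: "automorphism ar (composition ar M N) f" and fixed: "\<forall>x\<in>univ M \<times> A. f x = x"
      by auto
    \<comment> \<open>The fixed point \<open>(a, b)\<close> pins down the fibre over \<open>a\<close>.\<close>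
    have fibre: "fst (f (a, d)) = a" if "a \<in> univ M" "d \<in> univ N" for a d
      using automorphism_permutes_fibres[OF assms(2) f, of "(a, d)" "(a, b)"] that b A(1) fixed
      by auto
    moreover have "snd (f (a, d)) = d" if "a \<in> univ M" "d \<in> univ N" for a d
      using sem_rigid_overD[OF A(3) induced_automorphism_on_fibre[OF assms(2,3) f that(1)]]
        fibre fixed that
      by simp
    ultimately show "\<forall>x\<in>univ (composition ar M N). f x = x"
      by (auto simp: prod_eq_iff)
  qed
  then have "deg_rig ar (composition ar M N) \<le> enat (card (univ M \<times> A))"
    using A True by (intro deg_rig_le_card) auto
  then show ?thesis
    using True A(4) by (simp add: ecard_def card_cartesian_product)
next
  case False
  then have "ecard (univ M) * deg_rig ar N = \<infinity>"
    using ecard_times_deg_rig_finite_iff[OF assms(1,4)] by blast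
  then show ?thesis
    by simp
qed

text \<open>
  A finite base set \<open>B\<close> is the disjoint union of its sections.  None of them is empty because \<open>N\<close>
  is not rigid; hence \<open>M\<close> is finite and the sizes of the sections can be added.
\<close>

lemma product_le_deg_rig_composition:
  assumes "\<not> sem_rigid ar N"
  shows "ecard (univ M) * deg_rig ar N \<le> deg_rig ar (composition ar M N)"
proof (rule deg_rig_greatest)
  fix B assume B: "B \<subseteq> univ (composition ar M N)" "finite B"
    "sem_rigid_over ar (composition ar M N) B"
  have finite_section: "finite (B `` {a})" for a
    using B(2) by (intro finite_Image)
  have deg_le: "deg_rig ar N \<le> enat (card (B `` {a}))" if "a \<in> univ M" for a
    using B(1) finite_section rigid_over_section[OF B(3) that]
    by (intro deg_rig_le_card) auto
  have "B `` {a} \<noteq> {}" if "a \<in> univ M" for a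
    using rigid_over_section[OF B(3) that] assms by (auto simp: sem_rigid_def)
  then have "univ M \<subseteq> fst ` B"
    by force
  then have fin: "finite (univ M)"
    using B(2) by (meson finite_imageI finite_subset)
  show "ecard (univ M) * deg_rig ar N \<le> enat (card B)"
  proof (cases "univ M = {}")
    case True
    then show ?thesis by (simp add: ecard_def zero_enat_def[symmetric])
  next
    case False
    then obtain n where n: "deg_rig ar N = enat n"
      using deg_le by (metis enat_ile equals0I)
    have "card (univ M) * n \<le> (\<Sum>a\<in>univ M. card (B `` {a}))"
      using sum_bounded_below[of "univ M" n "\<lambda>a. card (B `` {a})"] deg_le n by simp
    also have "\<dots> = card (Sigma (univ M) (\<lambda>a. B `` {a}))"
      using fin finite_section by simp
    also have "Sigma (univ M) (\<lambda>a. B `` {a}) = B"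
      using B(1) by auto
    finally show ?thesis
      using n fin by (simp add: ecard_def)
  qed
qed

theorem theorem5p3:
  fixes ar :: "'r \<Rightarrow> nat"
    and M :: "('r, 'a) rel_struct"
    and N :: "('r, 'b) rel_struct"
  assumes "is_structure ar M"
    and "is_structure ar N"
    and "E_definable ar M N"
    and "fibres_are_copies ar M N"
  shows "(sem_rigid ar N \<and> constant_tuples_uniform ar M N \<longrightarrow>
            deg_rig ar (composition ar M N) = deg_rig ar M \<and>
            (deg_rig ar (composition ar M N) \<noteq> \<infinity> \<longleftrightarrow>
              deg_rig ar M \<noteq> \<infinity> \<and> deg_rig ar N \<noteq> \<infinity>)) \<and>
         (\<not> sem_rigid ar N \<longrightarrow>
            deg_rig ar (composition ar M N) = ecard (univ M) * deg_rig ar N \<and>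
            (deg_rig ar (composition ar M N) \<noteq> \<infinity> \<longleftrightarrow>
              deg_rig ar N \<noteq> \<infinity> \<and> finite (univ M)))"
proof -
  have nonempty: "univ M \<noteq> {}" "univ N \<noteq> {}"
    using assms(1,2) by (auto simp: is_structure_def)
  have "deg_rig ar (composition ar M N) = deg_rig ar M \<and> deg_rig ar N = 0"
    if "sem_rigid ar N" "constant_tuples_uniform ar M N"
    using deg_rig_composition_rigid[OF nonempty(2) assms(3,4) that] that(1)
    by (simp add: deg_rig_eq_0_iff)
  moreover have "deg_rig ar (composition ar M N) = ecard (univ M) * deg_rig ar N"
    if "\<not> sem_rigid ar N"
    using deg_rig_composition_le_product[OF nonempty(1) assms(3,4) that]
      product_le_deg_rig_composition[OF that] by (rule antisym)
  ultimately show ?thesis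
    using ecard_times_deg_rig_finite_iff[OF nonempty(1), of ar N] by simp
qed

end
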